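(* Let $\mathbb{W}$ be a locally small 2-category and let $G$ be a 2-generating family of objects of $\mathbb{W}$. Assume that the objects from $G$ have tensors with sets. If an object $C \in \mathbb{W}$ has all ad hoc simple products parametrised by $G$, then $C$ is representably posetal.
   Context: Locally small means that each $\hom_{\mathbb{W}}(X,Y)$ is a small category. 2-generating family: a class $G$ of objects of $\mathbb{W}$ such that for every pair of 2-morphisms $\alpha,\beta$ between parallel 1-morphisms $A\to B$ the following holds: if for every $X\in G$ and every 2-morphism $\tau$ between parallel 1-morphisms $X \to A$ one has $\alpha\circ\tau = \beta\circ\tau$ (horizontal composition), then $\alpha=\beta$. Tensor: for a set $\lambda$ (a discrete category) and $X \in \mathbb{W}$, the tensor $\lambda\otimes X$ is an object with a 2-natural isomorphism $\hom_{\mathbf{Cat}}(\lambda,\hom_{\mathbb{W}}(X,-))\cong\hom_{\mathbb{W}}(\lambda\otimes X,-)$; it is the 2-coproduct of $\lambda$ copies of $X$. A function $s\colon\lambda'\to\lambda$ induces a reindexing morphism $s\otimes X\colon\lambda'\otimes X\to\lambda\otimes X$. Ad hoc simple products parametrised by $G$: $C$ has all of them if for every $X\in G$, all sets $\lambda,\lambda'$, and every morphism $\tau\colon(\lambda\times\lambda')\otimes X\to C$, the right Kan extension of $\tau$ along $p\otimes X\colon(\lambda\times\lambda')\otimes X\to\lambda\otimes X$ exists in $\mathbb{W}$, where $p\colon\lambda\times\lambda'\to\lambda$ is the projection. Here the right Kan extension of $\tau\colon Z\to C$ along $s\colon Z\to Y$ is a morphism $\prod_s\tau\colon Y\to C$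 with bijections $\hom(h,\prod_s\tau)\cong\hom(h\circ s,\tau)$ natural in $h\colon Y\to C$. $C$ is representably posetal if for every object $X\in\mathbb{W}$ the category $\hom_{\mathbb{W}}(X,C)$ is a poset, in the sense that there is at most one morphism between any two of its objects. *)

theory Defs
  imports Main "HOL-Library.FuncSet"
begin

section \<open>Smallness\<close>

text \<open>
  The sets of the theory are the members of a Grothendieck universe. Up to bijection these are the
  sets of cardinality less than a regular strong limit cardinal \<open>\<kappa>\<close>, represented by the subsets of
  the type \<open>'u\<close> that underlies \<open>\<kappa>\<close>. Arbitrary subsets of the types of objects, 1-cells
  and 2-cells of a 2-category play the role of classes.
\<close>

definition universe_card :: "'u rel \<Rightarrow> bool" where
  "universe_card \<kappa> \<longleftrightarrow>
     card_order_on (Field \<kappa>) \<kappa> \<and> infinite (Field \<kappa>) \<and> regularCard \<kappa> \<and>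
     (\<forall>A :: 'u set. (card_of A, \<kappa>) \<in> ordLess \<longrightarrow> (card_of (Pow A), \<kappa>) \<in> ordLess)"

definition small :: "'u rel \<Rightarrow> 'a set \<Rightarrow> bool" where
  "small \<kappa> A \<longleftrightarrow> (card_of A, \<kappa>) \<in> ordLess"


section \<open>Categories\<close>

record ('a, 'b) cat =
  Obj :: "'a set"
  Arr :: "'b set"
  Dom :: "'b \<Rightarrow> 'a"
  Cod :: "'b \<Rightarrow> 'a"
  Idt :: "'a \<Rightarrow> 'b"
  Comp :: "'b \<Rightarrow> 'b \<Rightarrow> 'b"  \<comment> \<open>\<open>Comp C g f\<close> is \<open>g\<close> after \<open>f\<close>\<close>

definition Hom :: "('a, 'b) cat \<Rightarrow> 'a \<Rightarrow> 'a \<Rightarrow> 'b set" where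
  "Hom C a b = {f \<in> Arr C. Dom C f = a \<and> Cod C f = b}"

locale category =
  fixes C :: "('a, 'b) cat"
  assumes Dom_in: "f \<in> Arr C \<Longrightarrow> Dom C f \<in> Obj C"
    and Cod_in: "f \<in> Arr C \<Longrightarrow> Cod C f \<in> Obj C"
    and Idt_in: "a \<in> Obj C \<Longrightarrow> Idt C a \<in> Hom C a a"
    and Comp_in: "f \<in> Hom C a b \<Longrightarrow> g \<in> Hom C b c \<Longrightarrow> Comp C g f \<in> Hom C a c"
    and Comp_Idt: "f \<in> Hom C a b \<Longrightarrow> Comp C f (Idt C a) = f"
    and Idt_Comp: "f \<in> Hom C a b \<Longrightarrow> Comp C (Idt C b) f = f"
    and Comp_assoc: "f \<in> Hom C a b \<Longrightarrow> g \<in> Hom C b c \<Longrightarrow> h \<in> Hom C c d \<Longrightarrow>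
      Comp C h (Comp C g f) = Comp C (Comp C h g) f"

definition small_category :: "'u rel \<Rightarrow> ('a, 'b) cat \<Rightarrow> bool" where
  "small_category \<kappa> C \<longleftrightarrow> category C \<and> small \<kappa> (Obj C) \<and> small \<kappa> (Arr C)"

definition "functor" ::
  "('a, 'b) cat \<Rightarrow> ('c, 'd) cat \<Rightarrow> ('a \<Rightarrow> 'c) \<Rightarrow> ('b \<Rightarrow> 'd) \<Rightarrow> bool" where
  "functor C D Fo Fa \<longleftrightarrow>
     (\<forall>a \<in> Obj C. Fo a \<in> Obj D) \<and>
     (\<forall>f \<in> Arr C. Fa f \<in> Hom D (Fo (Dom C f)) (Fo (Cod C f))) \<and>
     (\<forall>a \<in> Obj C. Fa (Idt C a) = Idt D (Fo a)) \<and>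
     (\<forall>f \<in> Arr C. \<forall>g \<in> Arr C. Dom C g = Cod C f \<longrightarrow>
        Fa (Comp C g f) = Comp D (Fa g) (Fa f))"

definition cat_iso ::
  "('a, 'b) cat \<Rightarrow> ('c, 'd) cat \<Rightarrow> ('a \<Rightarrow> 'c) \<Rightarrow> ('b \<Rightarrow> 'd) \<Rightarrow> bool" where
  "cat_iso C D Fo Fa \<longleftrightarrow>
     functor C D Fo Fa \<and> bij_betw Fo (Obj C) (Obj D) \<and> bij_betw Fa (Arr C) (Arr D)"

text \<open>
  The category of functors from the discrete category \<open>L\<close> to \<open>C\<close>: such a functor is an
  \<open>L\<close>-indexed family of objects, and a natural transformation is an \<open>L\<close>-indexed family of arrows.
\<close>

definition functors_from_discrete :: "'i set \<Rightarrow> ('a, 'b) cat \<Rightarrow> ('i \<Rightarrow> 'a, 'i \<Rightarrow> 'b) cat" where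
  "functors_from_discrete L C =
     \<lparr>Obj = (L \<rightarrow>\<^sub>E Obj C),
      Arr = (L \<rightarrow>\<^sub>E Arr C),
      Dom = (\<lambda>f. \<lambda>i\<in>L. Dom C (f i)),
      Cod = (\<lambda>f. \<lambda>i\<in>L. Cod C (f i)),
      Idt = (\<lambda>a. \<lambda>i\<in>L. Idt C (a i)),
      Comp = (\<lambda>g f. \<lambda>i\<in>L. Comp C (g i) (f i))\<rparr>"


section \<open>2-categories\<close>

text \<open>
  A (strict) 2-category consists of its underlying category of objects and 1-cells, the category
  of 1-cells and 2-cells under vertical composition, and horizontal composition.
  \<open>HComp W \<beta> \<alpha>\<close> is \<open>\<beta>\<close> after \<open>\<alpha>\<close>.
\<close>

record ('o, 'f, 'c) two_cat =
  Und :: "('o, 'f) cat"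
  Vert :: "('f, 'c) cat"
  HComp :: "'c \<Rightarrow> 'c \<Rightarrow> 'c"

definition hom_cat :: "('o, 'f, 'c) two_cat \<Rightarrow> 'o \<Rightarrow> 'o \<Rightarrow> ('f, 'c) cat" where
  "hom_cat W X Y =
     (Vert W)\<lparr>Obj := Hom (Und W) X Y,
              Arr := {\<alpha> \<in> Arr (Vert W). Dom (Vert W) \<alpha> \<in> Hom (Und W) X Y \<and>
                                        Cod (Vert W) \<alpha> \<in> Hom (Und W) X Y}\<rparr>"

locale two_category =
  fixes W :: "('o, 'f, 'c) two_cat"
  assumes category_Und: "category (Und W)"
    and category_Vert: "category (Vert W)"
    and Obj_Vert: "Obj (Vert W) = Arr (Und W)"
    and globular: "\<alpha> \<in> Arr (Vert W) \<Longrightarrow>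
      \<alpha> \<in> Arr (hom_cat W (Dom (Und W) (Dom (Vert W) \<alpha>)) (Cod (Und W) (Dom (Vert W) \<alpha>)))"
    and HComp_in: "\<alpha> \<in> Arr (hom_cat W X Y) \<Longrightarrow> \<beta> \<in> Arr (hom_cat W Y Z) \<Longrightarrow>
      HComp W \<beta> \<alpha> \<in> Hom (Vert W)
        (Comp (Und W) (Dom (Vert W) \<beta>) (Dom (Vert W) \<alpha>))
        (Comp (Und W) (Cod (Vert W) \<beta>) (Cod (Vert W) \<alpha>))"
    and HComp_Idt: "f \<in> Hom (Und W) X Y \<Longrightarrow> g \<in> Hom (Und W) Y Z \<Longrightarrow>
      HComp W (Idt (Vert W) g) (Idt (Vert W) f) = Idt (Vert W) (Comp (Und W) g f)"
    and interchange:
      "\<alpha> \<in> Arr (hom_cat W X Y) \<Longrightarrow> \<alpha>' \<in> Arr (hom_cat W X Y) \<Longrightarrow>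
       \<beta> \<in> Arr (hom_cat W Y Z) \<Longrightarrow> \<beta>' \<in> Arr (hom_cat W Y Z) \<Longrightarrow>
       Dom (Vert W) \<alpha>' = Cod (Vert W) \<alpha> \<Longrightarrow> Dom (Vert W) \<beta>' = Cod (Vert W) \<beta> \<Longrightarrow>
       HComp W (Comp (Vert W) \<beta>' \<beta>) (Comp (Vert W) \<alpha>' \<alpha>) =
       Comp (Vert W) (HComp W \<beta>' \<alpha>') (HComp W \<beta> \<alpha>)"
    and HComp_unit_right: "\<alpha> \<in> Arr (hom_cat W X Y) \<Longrightarrow>
      HComp W \<alpha> (Idt (Vert W) (Idt (Und W) X)) = \<alpha>"
    and HComp_unit_left: "\<alpha> \<in> Arr (hom_cat W X Y) \<Longrightarrow>
      HComp W (Idt (Vert W) (Idt (Und W) Y)) \<alpha> = \<alpha>"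
    and HComp_assoc: "\<alpha> \<in> Arr (hom_cat W X Y) \<Longrightarrow> \<beta> \<in> Arr (hom_cat W Y Z) \<Longrightarrow>
      \<gamma> \<in> Arr (hom_cat W Z V) \<Longrightarrow>
      HComp W \<gamma> (HComp W \<beta> \<alpha>) = HComp W (HComp W \<gamma> \<beta>) \<alpha>"

definition objects :: "('o, 'f, 'c) two_cat \<Rightarrow> 'o set" where
  "objects W = Obj (Und W)"

definition whisker_left :: "('o, 'f, 'c) two_cat \<Rightarrow> 'f \<Rightarrow> 'c \<Rightarrow> 'c" where
  "whisker_left W g \<alpha> = HComp W (Idt (Vert W) g) \<alpha>"

definition whisker_right :: "('o, 'f, 'c) two_cat \<Rightarrow> 'c \<Rightarrow> 'f \<Rightarrow> 'c" where
  "whisker_right W \<beta> f = HComp W \<beta> (Idt (Vert W) f)"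

definition locally_small :: "'u rel \<Rightarrow> ('o, 'f, 'c) two_cat \<Rightarrow> bool" where
  "locally_small \<kappa> W \<longleftrightarrow>
     (\<forall>X \<in> objects W. \<forall>Y \<in> objects W. small_category \<kappa> (hom_cat W X Y))"

definition two_generating :: "('o, 'f, 'c) two_cat \<Rightarrow> 'o set \<Rightarrow> bool" where
  "two_generating W G \<longleftrightarrow> G \<subseteq> objects W \<and>
     (\<forall>A \<in> objects W. \<forall>B \<in> objects W.
      \<forall>f \<in> Obj (hom_cat W A B). \<forall>g \<in> Obj (hom_cat W A B).
      \<forall>\<alpha> \<in> Hom (hom_cat W A B) f g. \<forall>\<beta> \<in> Hom (hom_cat W A B) f g.
        (\<forall>X \<in> G. \<forall>\<tau> \<in> Arr (hom_cat W X A). HComp W \<alpha> \<tau> = HComp W \<beta> \<tau>) \<longrightarrow> \<alpha> = \<beta>)"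


section \<open>Tensors with sets\<close>

text \<open>
  \<open>TIso1 T Y\<close> and \<open>TIso2 T Y\<close> are the effects on objects and on arrows of the component at \<open>Y\<close> of
  the 2-natural isomorphism from \<open>hom (L, hom (X, -))\<close> to \<open>hom (Tensor T, -)\<close>.
\<close>

record ('i, 'o, 'f, 'c) tensor =
  Tensor :: 'o
  TIso1 :: "'o \<Rightarrow> ('i \<Rightarrow> 'f) \<Rightarrow> 'f"
  TIso2 :: "'o \<Rightarrow> ('i \<Rightarrow> 'c) \<Rightarrow> 'c"

text \<open>
  The last three conditions say that the isomorphisms commute with postcomposition by 1-cells, on
  objects and on arrows, and with postcomposition by 2-cells.
\<close>

definition is_tensor ::
  "('o, 'f, 'c) two_cat \<Rightarrow> 'i set \<Rightarrow> 'o \<Rightarrow> ('i, 'o, 'f, 'c) tensor \<Rightarrow> bool" where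
  "is_tensor W L X T \<longleftrightarrow> X \<in> objects W \<and> Tensor T \<in> objects W \<and>
     (\<forall>Y \<in> objects W.
        cat_iso (functors_from_discrete L (hom_cat W X Y)) (hom_cat W (Tensor T) Y)
          (TIso1 T Y) (TIso2 T Y)) \<and>
     (\<forall>Y \<in> objects W. \<forall>Y' \<in> objects W. \<forall>k \<in> Obj (hom_cat W Y Y').
      \<forall>f \<in> Obj (functors_from_discrete L (hom_cat W X Y)).
        TIso1 T Y' (\<lambda>i\<in>L. Comp (Und W) k (f i)) = Comp (Und W) k (TIso1 T Y f)) \<and>
     (\<forall>Y \<in> objects W. \<forall>Y' \<in> objects W. \<forall>k \<in> Obj (hom_cat W Y Y').
      \<forall>\<alpha> \<in> Arr (functors_from_discrete L (hom_cat W X Y)).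
        TIso2 T Y' (\<lambda>i\<in>L. whisker_left W k (\<alpha> i)) = whisker_left W k (TIso2 T Y \<alpha>)) \<and>
     (\<forall>Y \<in> objects W. \<forall>Y' \<in> objects W. \<forall>\<theta> \<in> Arr (hom_cat W Y Y').
      \<forall>f \<in> Obj (functors_from_discrete L (hom_cat W X Y)).
        TIso2 T Y' (\<lambda>i\<in>L. whisker_right W \<theta> (f i)) = whisker_right W \<theta> (TIso1 T Y f))"

definition has_tensors_with_sets :: "'u rel \<Rightarrow> ('o, 'f, 'c) two_cat \<Rightarrow> 'o \<Rightarrow> bool" where
  "has_tensors_with_sets \<kappa> W X \<longleftrightarrow>
     (\<forall>L :: 'u set. small \<kappa> L \<longrightarrow> (\<exists>T. is_tensor W L X T))"

text \<open>The coprojections of the tensor, as the 2-coproduct of \<open>L\<close> copies of \<open>X\<close>.\<close>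

definition coproj ::
  "('o, 'f, 'c) two_cat \<Rightarrow> 'i set \<Rightarrow> 'o \<Rightarrow> ('i, 'o, 'f, 'c) tensor \<Rightarrow> 'i \<Rightarrow> 'f" where
  "coproj W L X T =
     the_inv_into (Obj (functors_from_discrete L (hom_cat W X (Tensor T)))) (TIso1 T (Tensor T))
       (Idt (Und W) (Tensor T))"

text \<open>
  For \<open>s : L' \<rightarrow> L\<close> and tensors \<open>T'\<close> of \<open>X\<close> with \<open>L'\<close> and \<open>T\<close> of \<open>X\<close> with \<open>L\<close>, the induced
  1-cell \<open>s \<otimes> X\<close> from \<open>Tensor T'\<close> to \<open>Tensor T\<close>: on the copy of \<open>X\<close> indexed by \<open>j\<close> it is the
  coprojection indexed by \<open>s j\<close>.
\<close>

definition reindexing ::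
  "('o, 'f, 'c) two_cat \<Rightarrow> 'o \<Rightarrow> 'j set \<Rightarrow> ('j, 'o, 'f, 'c) tensor \<Rightarrow>
   'i set \<Rightarrow> ('i, 'o, 'f, 'c) tensor \<Rightarrow> ('j \<Rightarrow> 'i) \<Rightarrow> 'f" where
  "reindexing W X L' T' L T s = TIso1 T' (Tensor T) (\<lambda>j\<in>L'. coproj W L X T (s j))"


section \<open>Ad hoc simple products\<close>

definition is_right_kan_extension ::
  "('o, 'f, 'c) two_cat \<Rightarrow> 'o \<Rightarrow> 'o \<Rightarrow> 'o \<Rightarrow> 'f \<Rightarrow> 'f \<Rightarrow> 'f \<Rightarrow> bool" where
  "is_right_kan_extension W Z Y C s \<tau> R \<longleftrightarrow>
     Z \<in> objects W \<and> Y \<in> objects W \<and> C \<in> objects W \<and>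
     s \<in> Obj (hom_cat W Z Y) \<and> \<tau> \<in> Obj (hom_cat W Z C) \<and> R \<in> Obj (hom_cat W Y C) \<and>
     (\<exists>\<phi>. (\<forall>h \<in> Obj (hom_cat W Y C).
             bij_betw (\<phi> h) (Hom (hom_cat W Y C) h R)
               (Hom (hom_cat W Z C) (Comp (Und W) h s) \<tau>)) \<and>
          (\<forall>h \<in> Obj (hom_cat W Y C). \<forall>h' \<in> Obj (hom_cat W Y C).
           \<forall>\<gamma> \<in> Hom (hom_cat W Y C) h' h. \<forall>\<delta> \<in> Hom (hom_cat W Y C) h R.
             \<phi> h' (Comp (Vert W) \<delta> \<gamma>) = Comp (Vert W) (\<phi> h \<delta>) (whisker_right W \<gamma> s)))"

text \<open>
  Tensors are unique up to isomorphism only, so the tensors \<open>T\<close> and \<open>T'\<close> range over all choices.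
  Tensors with \<open>L \<times> L'\<close> exist whenever tensors with the small subsets of \<open>'u\<close> do, since
  \<open>L \<times> L'\<close> is in bijection with such a subset.
\<close>

definition has_adhoc_simple_products ::
  "'u rel \<Rightarrow> ('o, 'f, 'c) two_cat \<Rightarrow> 'o set \<Rightarrow> 'o \<Rightarrow> bool" where
  "has_adhoc_simple_products \<kappa> W G C \<longleftrightarrow>
     (\<forall>X \<in> G. \<forall>(L :: 'u set) (L' :: 'u set). small \<kappa> L \<longrightarrow> small \<kappa> L' \<longrightarrow>
       (\<forall>T T'. is_tensor W (L \<times> L') X T \<longrightarrow> is_tensor W L X T' \<longrightarrow>
         (\<forall>\<tau> \<in> Obj (hom_cat W (Tensor T) C).
           \<exists>R. is_right_kan_extension W (Tensor T) (Tensor T') C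
                 (reindexing W X (L \<times> L') T L T' fst) \<tau> R)))"

definition representably_posetal :: "('o, 'f, 'c) two_cat \<Rightarrow> 'o \<Rightarrow> bool" where
  "representably_posetal W C \<longleftrightarrow>
     (\<forall>X \<in> objects W. \<forall>f \<in> Obj (hom_cat W X C). \<forall>g \<in> Obj (hom_cat W X C).
      \<forall>\<alpha> \<in> Hom (hom_cat W X C) f g. \<forall>\<beta> \<in> Hom (hom_cat W X C) f g. \<alpha> = \<beta>)"

end

theory Submission
  imports Defs
begin

text \<open>
  This is Freyd's cardinality argument. Since \<open>G\<close> is 2-generating, it suffices to show that
  \<open>hom (X, C)\<close> is posetal for \<open>X \<in> G\<close>. Suppose that \<open>\<alpha> \<noteq> \<beta>\<close> are 2-cells from \<open>f\<close> to \<open>g\<close> there,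
  let \<open>1\<close> be a singleton, and let \<open>L'\<close> be a set equipotent to the set of arrows of
  \<open>hom (1 \<otimes> X, C)\<close>. The right Kan extension \<open>R\<close> of the constant family \<open>g\<close> along
  \<open>(1 \<times> L') \<otimes> X \<rightarrow> 1 \<otimes> X\<close> is an \<open>L'\<close>-th power of \<open>g\<close>, so the 2-cells from (the transpose
  of) \<open>f\<close> to \<open>R\<close> are the \<open>L'\<close>-indexed families of 2-cells from \<open>f\<close> to \<open>g\<close>. The families with
  values in \<open>{\<alpha>, \<beta>}\<close> already embed the power set of \<open>L'\<close> into \<open>L'\<close>, contradicting Cantor's theorem.
\<close>

section \<open>Small sets and cardinality\<close>

text \<open>Tensors are available only for index sets of type \<open>'u\<close>, while the arrows of
  a hom-category have another type. Since \<open>\<kappa>\<close> has the cardinality of its field,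
  a small set embeds there, and its image is the required copy.\<close>

lemma small_imp_bij:
  fixes \<kappa> :: "'u rel"
  assumes "card_order_on (Field \<kappa>) \<kappa>" "small \<kappa> A"
  obtains L :: "'u set" and b where "small \<kappa> L" "bij_betw b L A"
proof -
  have "(card_of (Field \<kappa>), \<kappa>) \<in> ordIso"
    using assms(1) by (metis card_of_Field_ordIso card_order_on_Card_order)
  then have "(card_of A, card_of (Field \<kappa>)) \<in> ordLeq"
    using assms(2) unfolding small_def
    by (meson ordIso_symmetric ordLess_imp_ordLeq ordLeq_ordIso_trans)
  then obtain h where h: "inj_on h A" "h ` A \<subseteq> Field \<kappa>"
    unfolding card_of_ordLeq[symmetric] by blast
  have bij: "bij_betw h A (h ` A)"
    using h(1) by (simp add: bij_betw_def)
  then have "(card_of (h ` A), card_of A) \<in> ordIso"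
    using card_of_ordIso ordIso_symmetric by blast
  then have "small \<kappa> (h ` A)"
    using assms(2) unfolding small_def by (rule ordIso_ordLess_trans)
  then show thesis
    using that bij_betw_inv_into[OF bij] by blast
qed

lemma small_singleton:
  fixes \<kappa> :: "'u rel"
  assumes "card_order_on (Field \<kappa>) \<kappa>" "infinite (Field \<kappa>)"
  shows "small \<kappa> {u}"
  unfolding small_def
  by (rule finite_ordLess_infinite)
    (use assms card_order_on_well_order_on card_of_Well_order in \<open>auto simp: Field_card_of\<close>)

section \<open>Reindexing tensors along bijections\<close>

lemma bij_betw_PiE_reindex:
  assumes e: "bij_betw e L K"
  shows "bij_betw (\<lambda>f. \<lambda>i\<in>L. f (e i)) (K \<rightarrow>\<^sub>E A) (L \<rightarrow>\<^sub>E A)"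
proof (rule bij_betw_byWitness[where f' = "\<lambda>g. \<lambda>k\<in>K. g (inv_into L e k)"])
  have e_in: "e i \<in> K" if "i \<in> L" for i
    using bij_betwE[OF e] that by blast
  have inv_in: "inv_into L e k \<in> L" "e (inv_into L e k) = k" if "k \<in> K" for k
    using bij_betwE[OF bij_betw_inv_into[OF e]] bij_betw_inv_into_right[OF e] that by blast+
  have inv_e: "inv_into L e (e i) = i" if "i \<in> L" for i
    using bij_betw_inv_into_left[OF e that] .
  show "\<forall>f \<in> K \<rightarrow>\<^sub>E A. (\<lambda>k\<in>K. (\<lambda>i\<in>L. f (e i)) (inv_into L e k)) = f"
  proof (intro ballI ext)
    fix f k assume f: "f \<in> K \<rightarrow>\<^sub>E A"
    show "(\<lambda>k\<in>K. (\<lambda>i\<in>L. f (e i)) (inv_into L e k)) k = f k"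
      using inv_in PiE_arb[OF f] by (cases "k \<in> K") simp_all
  qed
  show "\<forall>g \<in> L \<rightarrow>\<^sub>E A. (\<lambda>i\<in>L. (\<lambda>k\<in>K. g (inv_into L e k)) (e i)) = g"
  proof (intro ballI ext)
    fix g i assume g: "g \<in> L \<rightarrow>\<^sub>E A"
    show "(\<lambda>i\<in>L. (\<lambda>k\<in>K. g (inv_into L e k)) (e i)) i = g i"
      using e_in inv_e PiE_arb[OF g] by (cases "i \<in> L") simp_all
  qed
  show "(\<lambda>f. \<lambda>i\<in>L. f (e i)) ` (K \<rightarrow>\<^sub>E A) \<subseteq> L \<rightarrow>\<^sub>E A"
    using e_in by (intro image_subsetI) (simp add: PiE_iff)
  show "(\<lambda>g. \<lambda>k\<in>K. g (inv_into L e k)) ` (L \<rightarrow>\<^sub>E A) \<subseteq> K \<rightarrow>\<^sub>E A"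
    using inv_in by (intro image_subsetI) (simp add: PiE_iff)
qed

lemma functors_from_discrete_simps [simp]:
  "Obj (functors_from_discrete L C) = (L \<rightarrow>\<^sub>E Obj C)"
  "Arr (functors_from_discrete L C) = (L \<rightarrow>\<^sub>E Arr C)"
  "Dom (functors_from_discrete L C) \<alpha> = (\<lambda>i\<in>L. Dom C (\<alpha> i))"
  "Cod (functors_from_discrete L C) \<alpha> = (\<lambda>i\<in>L. Cod C (\<alpha> i))"
  "Idt (functors_from_discrete L C) a = (\<lambda>i\<in>L. Idt C (a i))"
  "Comp (functors_from_discrete L C) \<beta> \<alpha> = (\<lambda>i\<in>L. Comp C (\<beta> i) (\<alpha> i))"
  by (simp_all add: functors_from_discrete_def)

lemma cat_iso_reindex:
  assumes e: "bij_betw e L K"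
  shows "cat_iso (functors_from_discrete K C) (functors_from_discrete L C)
           (\<lambda>f. \<lambda>i\<in>L. f (e i)) (\<lambda>f. \<lambda>i\<in>L. f (e i))"
proof -
  have "e i \<in> K" if "i \<in> L" for i
    using bij_betwE[OF e] that by blast
  then have "functor (functors_from_discrete K C) (functors_from_discrete L C)
      (\<lambda>f. \<lambda>i\<in>L. f (e i)) (\<lambda>f. \<lambda>i\<in>L. f (e i))"
    unfolding functor_def Hom_def by (auto intro!: restrict_ext)
  then show ?thesis
    unfolding cat_iso_def functors_from_discrete_simps
    by (intro conjI bij_betw_PiE_reindex[OF e])
qed

lemma cat_iso_trans:
  assumes "cat_iso C D Fo Fa" "cat_iso D E Go Ga"
  shows "cat_iso C E (\<lambda>a. Go (Fo a)) (\<lambda>f. Ga (Fa f))"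
proof -
  have "functor C E (\<lambda>a. Go (Fo a)) (\<lambda>f. Ga (Fa f))"
    using assms unfolding cat_iso_def functor_def Hom_def by auto
  moreover have "bij_betw (\<lambda>a. Go (Fo a)) (Obj C) (Obj E)" "bij_betw (\<lambda>f. Ga (Fa f)) (Arr C) (Arr E)"
    using bij_betw_trans[of Fo _ _ Go] bij_betw_trans[of Fa _ _ Ga] assms
    unfolding cat_iso_def comp_def by metis+
  ultimately show ?thesis
    unfolding cat_iso_def by blast
qed

text \<open>Needed for index sets of pairs, which are not subsets of \<open>'u\<close>. Families
  over \<open>K\<close> are reindexed to families over \<open>L\<close> before the isomorphisms of
  \<open>T\<close> are applied; this is invertible and commutes with pointwise operations, hence
  preserves 2-naturality.\<close>

lemma is_tensor_reindex:
  assumes e: "bij_betw e L K" and T: "is_tensor W L X T"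
  shows "is_tensor W K X
    \<lparr>Tensor = Tensor T, TIso1 = \<lambda>Y f. TIso1 T Y (\<lambda>i\<in>L. f (e i)),
     TIso2 = \<lambda>Y \<alpha>. TIso2 T Y (\<lambda>i\<in>L. \<alpha> (e i))\<rparr>"
proof -
  have e_in: "e i \<in> K" if "i \<in> L" for i
    using bij_betwE[OF e] that by blast
  have PiE: "(\<lambda>i\<in>L. f (e i)) \<in> L \<rightarrow>\<^sub>E A" if "f \<in> K \<rightarrow>\<^sub>E A" for f :: "_ \<Rightarrow> 'x" and A
    using PiE_mem[OF that e_in] by simp
  \<comment> \<open>With \<open>t\<close> a postcomposition or whiskering, this rewrites each
    naturality condition over \<open>K\<close> into the condition for \<open>T\<close> at the
    reindexed family.\<close>
  have restr: "(\<lambda>i\<in>L. (\<lambda>k\<in>K. t (f k)) (e i)) = (\<lambda>i\<in>L. t ((\<lambda>i\<in>L. f (e i)) i))"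
    for t :: "'x \<Rightarrow> 'y" and f
    using e_in by (intro restrict_ext) simp
  note T = T[unfolded is_tensor_def functors_from_discrete_simps]
  show ?thesis
    unfolding is_tensor_def functors_from_discrete_simps tensor.simps restr
  proof (intro conjI ballI)
    fix Y assume "Y \<in> objects W"
    then show "cat_iso (functors_from_discrete K (hom_cat W X Y)) (hom_cat W (Tensor T) Y)
        (\<lambda>f. TIso1 T Y (\<lambda>i\<in>L. f (e i))) (\<lambda>\<alpha>. TIso2 T Y (\<lambda>i\<in>L. \<alpha> (e i)))"
      using T by (intro cat_iso_trans[OF cat_iso_reindex[OF e]]) blast
  qed (use T PiE in blast)+
qed

section \<open>Hom-categories and the universal property of tensors\<close>

lemma hom_cat_simps [simp]:
  "Obj (hom_cat W X Y) = Hom (Und W) X Y"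
  "Dom (hom_cat W X Y) = Dom (Vert W)"
  "Cod (hom_cat W X Y) = Cod (Vert W)"
  by (simp_all add: hom_cat_def)

lemma Arr_hom_cat:
  "\<alpha> \<in> Arr (hom_cat W X Y) \<longleftrightarrow> \<alpha> \<in> Arr (Vert W) \<and>
     Dom (Vert W) \<alpha> \<in> Hom (Und W) X Y \<and> Cod (Vert W) \<alpha> \<in> Hom (Und W) X Y"
  by (simp add: hom_cat_def)

lemma is_tensorD:
  assumes "is_tensor W L X T"
  shows "Tensor T \<in> objects W"
    and "Y \<in> objects W \<Longrightarrow>
      bij_betw (TIso1 T Y) (L \<rightarrow>\<^sub>E Hom (Und W) X Y) (Hom (Und W) (Tensor T) Y)"
  using assms by (simp_all add: is_tensor_def cat_iso_def)

lemma TIso1_in: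
  assumes "is_tensor W L X T" "Y \<in> objects W" "f \<in> L \<rightarrow>\<^sub>E Hom (Und W) X Y"
  shows "TIso1 T Y f \<in> Hom (Und W) (Tensor T) Y"
  using bij_betwE[OF is_tensorD(2)[OF assms(1,2)]] assms(3) by blast

context two_category
begin

lemma HComp_in_Hom:
  assumes "\<tau> \<in> Arr (hom_cat W X Y)" "\<alpha> \<in> Hom (hom_cat W Y Z) f g"
  shows "HComp W \<alpha> \<tau> \<in> Hom (hom_cat W X Z)
    (Comp (Und W) f (Dom (Vert W) \<tau>)) (Comp (Und W) g (Cod (Vert W) \<tau>))"
proof -
  have \<alpha>: "\<alpha> \<in> Arr (hom_cat W Y Z)" "Dom (Vert W) \<alpha> = f" "Cod (Vert W) \<alpha> = g"
    using assms(2) by (auto simp: Hom_def)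
  then have "Comp (Und W) f (Dom (Vert W) \<tau>) \<in> Hom (Und W) X Z"
    and "Comp (Und W) g (Cod (Vert W) \<tau>) \<in> Hom (Und W) X Z"
    using assms(1) by (auto simp: Arr_hom_cat intro: category.Comp_in[OF category_Und])
  then show ?thesis
    using HComp_in[OF assms(1) \<alpha>(1)] \<alpha>(2,3)
    by (simp add: Hom_def[of "Vert W"] Hom_def[of "hom_cat W X Z"] Arr_hom_cat)
qed

lemma coproj_in:
  assumes "is_tensor W L X T"
  shows "coproj W L X T \<in> L \<rightarrow>\<^sub>E Hom (Und W) X (Tensor T)"
    and "TIso1 T (Tensor T) (coproj W L X T) = Idt (Und W) (Tensor T)"
proof -
  have obj: "Tensor T \<in> objects W"
    and bij: "bij_betw (TIso1 T (Tensor T)) (L \<rightarrow>\<^sub>E Hom (Und W) X (Tensor T))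
      (Hom (Und W) (Tensor T) (Tensor T))"
    using is_tensorD[OF assms] by blast+
  have id: "Idt (Und W) (Tensor T) \<in> Hom (Und W) (Tensor T) (Tensor T)"
    using category.Idt_in[OF category_Und] obj by (simp add: objects_def)
  show "coproj W L X T \<in> L \<rightarrow>\<^sub>E Hom (Und W) X (Tensor T)"
    unfolding coproj_def functors_from_discrete_simps hom_cat_simps
    using bij_betwE[OF bij_betw_the_inv_into[OF bij]] id by blast
  show "TIso1 T (Tensor T) (coproj W L X T) = Idt (Und W) (Tensor T)"
    unfolding coproj_def functors_from_discrete_simps hom_cat_simps
    using f_the_inv_into_f_bij_betw[OF bij] id by blast
qed

lemma TIso1_natural:
  assumes "is_tensor W L X T" "Y \<in> objects W" "Y' \<in> objects W" "k \<in> Hom (Und W) Y Y'"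
    and "f \<in> L \<rightarrow>\<^sub>E Hom (Und W) X Y"
  shows "TIso1 T Y' (\<lambda>i\<in>L. Comp (Und W) k (f i)) = Comp (Und W) k (TIso1 T Y f)"
  using assms unfolding is_tensor_def by simp

text \<open>A Yoneda argument: the coprojections correspond to the identity, so by naturality their
  composites with \<open>TIso1 T Y f\<close> form a family that \<open>TIso1 T Y\<close> sends to
  \<open>TIso1 T Y f\<close>. Injectivity identifies this family with \<open>f\<close>.\<close>

lemma Comp_TIso1_coproj:
  assumes T: "is_tensor W L X T" and Y: "Y \<in> objects W"
    and f: "f \<in> L \<rightarrow>\<^sub>E Hom (Und W) X Y" and i: "i \<in> L"
  shows "Comp (Und W) (TIso1 T Y f) (coproj W L X T i) = f i"
proof -
  have obj: "Tensor T \<in> objects W"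
    and bij: "bij_betw (TIso1 T Y) (L \<rightarrow>\<^sub>E Hom (Und W) X Y) (Hom (Und W) (Tensor T) Y)"
    using is_tensorD[OF T] Y by blast+
  have h: "TIso1 T Y f \<in> Hom (Und W) (Tensor T) Y"
    using TIso1_in[OF T Y f] .
  have c: "coproj W L X T \<in> L \<rightarrow>\<^sub>E Hom (Und W) X (Tensor T)"
    using coproj_in(1)[OF T] .
  have "TIso1 T Y (\<lambda>i\<in>L. Comp (Und W) (TIso1 T Y f) (coproj W L X T i)) = TIso1 T Y f"
    using TIso1_natural[OF T obj Y h c] coproj_in(2)[OF T]
      category.Comp_Idt[OF category_Und h] by simp
  moreover have "(\<lambda>i\<in>L. Comp (Und W) (TIso1 T Y f) (coproj W L X T i)) \<in> L \<rightarrow>\<^sub>E Hom (Und W) X Y"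
    using c category.Comp_in[OF category_Und _ h] by (auto simp: PiE_iff)
  ultimately have "(\<lambda>i\<in>L. Comp (Und W) (TIso1 T Y f) (coproj W L X T i)) = f"
    using bij f by (blast dest: inj_onD bij_betw_imp_inj_on)
  then show ?thesis
    using i by (metis restrict_apply')
qed

text \<open>The reindexing 1-cell corresponds to a family of coprojections, so naturality moves the
  composition inside the family, where each coprojection picks out a component of
  \<open>f\<close>.\<close>

lemma Comp_TIso1_reindexing:
  assumes T': "is_tensor W L' X T'" and T: "is_tensor W L X T" and Y: "Y \<in> objects W"
    and f: "f \<in> L \<rightarrow>\<^sub>E Hom (Und W) X Y" and s: "s \<in> L' \<rightarrow> L"
  shows "Comp (Und W) (TIso1 T Y f) (reindexing W X L' T' L T s) = TIso1 T' Y (\<lambda>j\<in>L'. f (s j))"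
proof -
  have obj: "Tensor T \<in> objects W" and h: "TIso1 T Y f \<in> Hom (Und W) (Tensor T) Y"
    using is_tensorD(1)[OF T] TIso1_in[OF T Y f] by blast+
  have c: "(\<lambda>j\<in>L'. coproj W L X T (s j)) \<in> L' \<rightarrow>\<^sub>E Hom (Und W) X (Tensor T)"
    using coproj_in(1)[OF T] s by auto
  have "Comp (Und W) (TIso1 T Y f) (reindexing W X L' T' L T s) =
      TIso1 T' Y (\<lambda>j\<in>L'. Comp (Und W) (TIso1 T Y f) ((\<lambda>j\<in>L'. coproj W L X T (s j)) j))"
    unfolding reindexing_def by (rule TIso1_natural[OF T' obj Y h c, symmetric])
  also have "(\<lambda>j\<in>L'. Comp (Und W) (TIso1 T Y f) ((\<lambda>j\<in>L'. coproj W L X T (s j)) j)) =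
      (\<lambda>j\<in>L'. f (s j))"
    using Comp_TIso1_coproj[OF T Y f] s by (intro restrict_ext) (simp add: Pi_iff)
  finally show ?thesis .
qed

text \<open>Functoriality determines the source and target of the image, here given by constant
  families. The embedding bounds from below the number of 2-cells between such 1-cells.\<close>

lemma TIso2_inj_on:
  assumes T: "is_tensor W L X T" and Y: "Y \<in> objects W"
  shows "inj_on (TIso2 T Y) (L \<rightarrow>\<^sub>E Hom (hom_cat W X Y) f g)"
    and "TIso2 T Y ` (L \<rightarrow>\<^sub>E Hom (hom_cat W X Y) f g) \<subseteq>
      Hom (hom_cat W (Tensor T) Y) (TIso1 T Y (\<lambda>i\<in>L. f)) (TIso1 T Y (\<lambda>i\<in>L. g))"
proof -
  have iso: "cat_iso (functors_from_discrete L (hom_cat W X Y)) (hom_cat W (Tensor T) Y)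
      (TIso1 T Y) (TIso2 T Y)"
    using T Y by (simp add: is_tensor_def)
  have sub: "L \<rightarrow>\<^sub>E Hom (hom_cat W X Y) f g \<subseteq> L \<rightarrow>\<^sub>E Arr (hom_cat W X Y)"
    by (rule PiE_mono) (auto simp: Hom_def)
  show "inj_on (TIso2 T Y) (L \<rightarrow>\<^sub>E Hom (hom_cat W X Y) f g)"
    using iso by (intro inj_on_subset[OF _ sub]) (simp add: cat_iso_def bij_betw_def)
  show "TIso2 T Y ` (L \<rightarrow>\<^sub>E Hom (hom_cat W X Y) f g) \<subseteq>
      Hom (hom_cat W (Tensor T) Y) (TIso1 T Y (\<lambda>i\<in>L. f)) (TIso1 T Y (\<lambda>i\<in>L. g))"
  proof (rule image_subsetI)
    fix \<alpha> assume \<alpha>: "\<alpha> \<in> L \<rightarrow>\<^sub>E Hom (hom_cat W X Y) f g"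
    have "\<alpha> \<in> L \<rightarrow>\<^sub>E Arr (hom_cat W X Y)"
      using \<alpha> sub by blast
    then have "TIso2 T Y \<alpha> \<in> Hom (hom_cat W (Tensor T) Y)
        (TIso1 T Y (\<lambda>i\<in>L. Dom (Vert W) (\<alpha> i))) (TIso1 T Y (\<lambda>i\<in>L. Cod (Vert W) (\<alpha> i)))"
      using iso by (simp add: cat_iso_def functor_def)
    moreover have "(\<lambda>i\<in>L. Dom (Vert W) (\<alpha> i)) = (\<lambda>i\<in>L. f)" "(\<lambda>i\<in>L. Cod (Vert W) (\<alpha> i)) = (\<lambda>i\<in>L. g)"
      using \<alpha> by (auto intro!: restrict_ext simp: PiE_iff Hom_def)
    ultimately show "TIso2 T Y \<alpha> \<in>
        Hom (hom_cat W (Tensor T) Y) (TIso1 T Y (\<lambda>i\<in>L. f)) (TIso1 T Y (\<lambda>i\<in>L. g))"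
      by simp
  qed
qed

section \<open>The cardinality contradiction at a generator\<close>

lemma generator_hom_posetal:
  fixes \<kappa> :: "'u rel"
  assumes \<kappa>: "card_order_on (Field \<kappa>) \<kappa>" "infinite (Field \<kappa>)"
    and ls: "locally_small \<kappa> W" and X: "X \<in> G" and tens: "has_tensors_with_sets \<kappa> W X"
    and C: "C \<in> objects W" and prods: "has_adhoc_simple_products \<kappa> W G C"
    and f: "f \<in> Hom (Und W) X C" and g: "g \<in> Hom (Und W) X C"
    and \<alpha>: "\<alpha> \<in> Hom (hom_cat W X C) f g" and \<beta>: "\<beta> \<in> Hom (hom_cat W X C) f g"
  shows "\<alpha> = \<beta>"
proof (rule ccontr)
  assume neq: "\<alpha> \<noteq> \<beta>"
  obtain u where "u \<in> Field \<kappa>"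
    using infinite_imp_nonempty[OF \<kappa>(2)] by blast
  \<comment> \<open>The Kan extensions at hand are along projections between tensors of
    \<open>X\<close>, so \<open>X\<close> itself is replaced by its tensor with a singleton.\<close>
  let ?L = "{u}"
  have sL: "small \<kappa> ?L"
    using small_singleton[OF \<kappa>] .
  obtain T where T: "is_tensor W ?L X T"
    using tens sL unfolding has_tensors_with_sets_def by blast
  then have "small \<kappa> (Arr (hom_cat W (Tensor T) C))"
    using ls C unfolding locally_small_def small_category_def is_tensor_def by blast
  \<comment> \<open>All arrows are counted, because \<open>R\<close> depends on \<open>L'\<close>:
    the bound must hold for 2-cells into whatever \<open>R\<close> arises.\<close>
  then obtain L' :: "'u set" and b
    where sL': "small \<kappa> L'" and b: "bij_betw b L' (Arr (hom_cat W (Tensor T) C))"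
    by (rule small_imp_bij[OF \<kappa>(1)])
  let ?P = "?L \<times> L'"
  obtain T0 where T0: "is_tensor W L' X T0"
    using tens sL' unfolding has_tensors_with_sets_def by blast
  \<comment> \<open>The tensor with the set of pairs \<open>?P\<close> is transported from the one
    with \<open>L'\<close>.\<close>
  have "bij_betw (Pair u) L' ?P"
    unfolding bij_betw_def inj_on_def by blast
  then obtain T' where T': "is_tensor W ?P X T'"
    using is_tensor_reindex[OF _ T0] by blast
  let ?s = "reindexing W X ?P T' ?L T fst"
  let ?h = "TIso1 T C (\<lambda>i\<in>?L. f)"
  let ?\<tau> = "TIso1 T' C (\<lambda>j\<in>?P. g)"
  have h: "?h \<in> Hom (Und W) (Tensor T) C"
    by (intro TIso1_in[OF T C] restrict_PiE_iff[THEN iffD2] ballI f)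
  have "?\<tau> \<in> Hom (Und W) (Tensor T') C"
    by (intro TIso1_in[OF T' C] restrict_PiE_iff[THEN iffD2] ballI g)
  then obtain R where "is_right_kan_extension W (Tensor T') (Tensor T) C ?s ?\<tau> R"
    using prods[unfolded has_adhoc_simple_products_def hom_cat_simps] X sL sL' T T' by blast
  then obtain \<phi> where \<phi>: "bij_betw \<phi> (Hom (hom_cat W (Tensor T) C) ?h R)
      (Hom (hom_cat W (Tensor T') C) (Comp (Und W) ?h ?s) ?\<tau>)"
    using h unfolding is_right_kan_extension_def hom_cat_simps by blast
  \<comment> \<open>Restricting \<open>?h\<close> along the projection gives the constant family
    \<open>f\<close> on \<open>?P\<close>, so the target of \<open>\<phi>\<close> consists of
    2-cells between constant families.\<close>
  have "Comp (Und W) ?h ?s = TIso1 T' C (\<lambda>j\<in>?P. (\<lambda>i\<in>?L. f) (fst j))"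
    by (intro Comp_TIso1_reindexing[OF T' T C] restrict_PiE_iff[THEN iffD2] ballI f) auto
  also have "(\<lambda>j\<in>?P. (\<lambda>i\<in>?L. f) (fst j)) = (\<lambda>j\<in>?P. f)"
    by (auto intro!: restrict_ext)
  finally have hs: "Comp (Und W) ?h ?s = TIso1 T' C (\<lambda>j\<in>?P. f)" .
  \<comment> \<open>Characteristic functions with values \<open>\<alpha>\<close> and
    \<open>\<beta>\<close>; they separate subsets because
    \<open>\<alpha> \<noteq> \<beta>\<close>.\<close>
  define \<chi> where "\<chi> A = (\<lambda>j\<in>?P. if snd j \<in> A then \<alpha> else \<beta>)" for A
  have "inj_on \<chi> (Pow L')"
  proof (rule inj_onI)
    fix A B assume AB: "A \<in> Pow L'" "B \<in> Pow L'" "\<chi> A = \<chi> B"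
    have "i \<in> A \<longleftrightarrow> i \<in> B" if "i \<in> L'" for i
      using fun_cong[OF AB(3), of "(u, i)"] that neq by (auto simp: \<chi>_def split: if_splits)
    then show "A = B"
      using AB(1,2) by blast
  qed
  moreover have "\<chi> ` Pow L' \<subseteq> ?P \<rightarrow>\<^sub>E Hom (hom_cat W X C) f g"
    unfolding \<chi>_def using \<alpha> \<beta> by (intro image_subsetI restrict_PiE_iff[THEN iffD2] ballI) simp
  \<comment> \<open>The chain of comparisons runs from subsets to families, then by
    \<open>TIso2\<close> to 2-cells into \<open>?\<tau>\<close>, by \<open>\<phi>\<close> to 2-cells
    into \<open>R\<close>, and finally to all arrows, counted by \<open>L'\<close>.\<close>
  ultimately have "(card_of (Pow L'), card_of (?P \<rightarrow>\<^sub>E Hom (hom_cat W X C) f g)) \<in> ordLeq"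
    by (intro card_of_ordLeq[THEN iffD1] exI conjI)
  also have "(card_of (?P \<rightarrow>\<^sub>E Hom (hom_cat W X C) f g),
      card_of (Hom (hom_cat W (Tensor T') C) (Comp (Und W) ?h ?s) ?\<tau>)) \<in> ordLeq"
    unfolding hs by (rule card_of_ordLeq[THEN iffD1, OF exI, OF conjI, OF TIso2_inj_on[OF T' C]])
  also have "(card_of (Hom (hom_cat W (Tensor T') C) (Comp (Und W) ?h ?s) ?\<tau>),
      card_of (Hom (hom_cat W (Tensor T) C) ?h R)) \<in> ordIso"
    by (rule ordIso_symmetric[OF card_of_ordIso[THEN iffD1, OF exI, OF \<phi>]])
  also have "(card_of (Hom (hom_cat W (Tensor T) C) ?h R),
      card_of (Arr (hom_cat W (Tensor T) C))) \<in> ordLeq"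
    by (rule card_of_mono1) (auto simp: Hom_def)
  also have "(card_of (Arr (hom_cat W (Tensor T) C)), card_of L') \<in> ordIso"
    by (rule ordIso_symmetric[OF card_of_ordIso[THEN iffD1, OF exI, OF b]])
  finally have "(card_of (Pow L'), card_of L') \<in> ordLeq" .
  then show False
    using card_of_Pow not_ordLess_ordLeq by blast
qed

end

section \<open>Passage from generators to arbitrary objects\<close>

theorem theorem2:
  fixes \<kappa> :: "'u rel"
    and W :: "('o, 'f, 'c) two_cat"
    and G :: "'o set"
    and C :: 'o
  assumes "universe_card \<kappa>"
    and "two_category W"
    and "locally_small \<kappa> W"
    and "two_generating W G"
    and "\<forall>X \<in> G. has_tensors_with_sets \<kappa> W X"
    and "C \<in> objects W"
    and "has_adhoc_simple_products \<kappa> W G C"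
  shows "representably_posetal W C"
  unfolding representably_posetal_def
proof (intro ballI)
  interpret two_category W by fact
  fix A f g \<alpha> \<beta>
  assume A: "A \<in> objects W" and f: "f \<in> Obj (hom_cat W A C)" and g: "g \<in> Obj (hom_cat W A C)"
    and \<alpha>: "\<alpha> \<in> Hom (hom_cat W A C) f g" and \<beta>: "\<beta> \<in> Hom (hom_cat W A C) f g"
  \<comment> \<open>Composing with \<open>\<tau>\<close> turns \<open>\<alpha>\<close> and
    \<open>\<beta>\<close> into parallel 2-cells from a generator to \<open>C\<close>, which must
    coincide; 2-generation then gives \<open>\<alpha> = \<beta>\<close>.\<close>
  have "HComp W \<alpha> \<tau> = HComp W \<beta> \<tau>" if X: "X \<in> G" and \<tau>: "\<tau> \<in> Arr (hom_cat W X A)" for X \<tau>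
  proof (rule generator_hom_posetal)
    show "card_order_on (Field \<kappa>) \<kappa>" "infinite (Field \<kappa>)"
      using \<open>universe_card \<kappa>\<close> by (simp_all add: universe_card_def)
    show "Comp (Und W) f (Dom (Vert W) \<tau>) \<in> Hom (Und W) X C"
      and "Comp (Und W) g (Cod (Vert W) \<tau>) \<in> Hom (Und W) X C"
      using f g \<tau> by (auto simp: Arr_hom_cat intro: category.Comp_in[OF category_Und])
  qed (use assms X HComp_in_Hom[OF \<tau>] \<alpha> \<beta> in auto)
  then show "\<alpha> = \<beta>"
    using \<open>two_generating W G\<close> A \<open>C \<in> objects W\<close> f g \<alpha> \<beta> unfolding two_generating_def by blast
qed

end
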